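(* Let $\mathfrak C$ be a permutational category with parent group $\Gamma$, and let $\mathcal O$ be an object of $\mathfrak C$, identified with a permutation representation $\theta:\Gamma\to S:={\rm Sym}(\Omega)$, with monodromy group $G:=\theta(\Gamma)$. If $\mathcal O$ is connected, then $${\rm Aut}_{\mathfrak C}({\mathcal O})\cong N_G(H)/H\cong N_{\Gamma}(M)/M,$$ where $H=G_\alpha$ and $M=\Gamma_\alpha$ are the stabilisers in $G$ and in $\Gamma$ (acting via $\theta$) of some $\alpha\in\Omega$.
   Context: A permutational category $\mathfrak C$ with parent group $\Gamma$ is a category whose objects $\mathcal O$ are identified with the permutation representations $\theta:\Gamma\to S={\rm Sym}(\Omega)$ of the group $\Gamma$ on sets $\Omega$, and whose morphisms $\mathcal O_1\to\mathcal O_2$ are identified with the functions $\Omega_1\to\Omega_2$ commuting with the actions of $\Gamma$ on the corresponding sets $\Omega_1$ and $\Omega_2$. Permutations act on the right. The group $\Gamma$ and the set $\Omega$ may be infinite. The monodromy group of $\mathcal O$ is $G=\theta(\Gamma)\le S$. The automorphism group ${\rm Aut}_{\mathfrak C}(\mathcal O)$ is the group of all permutations of $\Omega$ commuting with the action of $\Gamma$, that is, the centraliser $C_S(G)$ of $G$ in $S$. The object $\mathcal O$ is connected if $\Gamma$ (equivalently $G$) acts transitively on $\Omega$ (with $\Omega$ non-empty). $N_X(Y)$ denotes the normaliser of the subgroup $Y$ in the group $X$. *)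

theory Defs
  imports "HOL-Algebra.Group_Action"
begin

text \<open>Composition is written in diagrammatic order: \<open>comp C f g\<close> is ``first \<open>f\<close>, then \<open>g\<close>''.
  Morphisms carry their domain and codomain, so that composition needs no further arguments; it is
  unspecified on pairs that are not composable.\<close>

record ('o, 'm) cat =
  Obj :: "'o set"
  Mor :: "'m set"
  source :: "'m \<Rightarrow> 'o"
  target :: "'m \<Rightarrow> 'o"
  ident :: "'o \<Rightarrow> 'm"
  comp :: "'m \<Rightarrow> 'm \<Rightarrow> 'm"

definition Hom :: "('o, 'm) cat \<Rightarrow> 'o \<Rightarrow> 'o \<Rightarrow> 'm set"
  where "Hom C A B = {f \<in> Mor C. source C f = A \<and> target C f = B}"

locale category =
  fixes C :: "('o, 'm) cat"
  assumes source_Obj: "f \<in> Mor C \<Longrightarrow> source C f \<in> Obj C"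
    and target_Obj: "f \<in> Mor C \<Longrightarrow> target C f \<in> Obj C"
    and ident_Hom: "A \<in> Obj C \<Longrightarrow> ident C A \<in> Hom C A A"
    and comp_Hom: "\<lbrakk>f \<in> Hom C A B; g \<in> Hom C B D\<rbrakk> \<Longrightarrow> comp C f g \<in> Hom C A D"
    and comp_ident_left: "f \<in> Hom C A B \<Longrightarrow> comp C (ident C A) f = f"
    and comp_ident_right: "f \<in> Hom C A B \<Longrightarrow> comp C f (ident C B) = f"
    and comp_assoc: "\<lbrakk>f \<in> Hom C A B; g \<in> Hom C B D; h \<in> Hom C D E\<rbrakk>
      \<Longrightarrow> comp C (comp C f g) h = comp C f (comp C g h)"

definition End_monoid :: "('o, 'm) cat \<Rightarrow> 'o \<Rightarrow> 'm monoid"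
  where "End_monoid C A = \<lparr>carrier = Hom C A A, mult = comp C, one = ident C A\<rparr>"

text \<open>The automorphisms of an object are its invertible endomorphisms.\<close>

definition Aut :: "('o, 'm) cat \<Rightarrow> 'o \<Rightarrow> 'm monoid"
  where "Aut C A = units_of (End_monoid C A)"


text \<open>Permutations act on the right, so the product of \<open>f\<close> and \<open>g\<close> in the symmetric group is
  ``first \<open>f\<close>, then \<open>g\<close>'', whereas the product in \<^const>\<open>BijGroup\<close> is ``first \<open>g\<close>, then \<open>f\<close>''.
  The image of a point \<open>x\<close> under \<open>f\<close> is still written \<open>f x\<close>.\<close>

definition Sym :: "'w set \<Rightarrow> ('w \<Rightarrow> 'w) monoid"
  where "Sym \<Omega> = (BijGroup \<Omega>)\<lparr>mult := \<lambda>f g. g \<otimes>\<^bsub>BijGroup \<Omega>\<^esub> f\<rparr>"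

definition perm_reps :: "('g, 'p) monoid_scheme \<Rightarrow> ('w set \<times> ('g \<Rightarrow> 'w \<Rightarrow> 'w)) set"
  where "perm_reps \<Gamma> = {(\<Omega>, \<theta>). \<theta> \<in> hom \<Gamma> (Sym \<Omega>)}"

fun equivariant_maps :: "('g, 'p) monoid_scheme
    \<Rightarrow> 'w set \<times> ('g \<Rightarrow> 'w \<Rightarrow> 'w) \<Rightarrow> 'v set \<times> ('g \<Rightarrow> 'v \<Rightarrow> 'v) \<Rightarrow> ('w \<Rightarrow> 'v) set"
  where "equivariant_maps \<Gamma> (\<Omega>\<^sub>1, \<theta>\<^sub>1) (\<Omega>\<^sub>2, \<theta>\<^sub>2) =
    {f \<in> \<Omega>\<^sub>1 \<rightarrow>\<^sub>E \<Omega>\<^sub>2. \<forall>\<gamma> \<in> carrier \<Gamma>. \<forall>x \<in> \<Omega>\<^sub>1. f (\<theta>\<^sub>1 \<gamma> x) = \<theta>\<^sub>2 \<gamma> (f x)}"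

text \<open>The identification of objects and morphisms with permutation representations and equivariant
  functions is an equivalence of categories \<open>(rep, fn)\<close>: functorial, bijective on each set of
  morphisms, and such that every permutation representation is isomorphic to that of some object.
  In particular, \<open>rep\<close> may be a bijection.\<close>

locale permutational_category = group \<Gamma> + category \<CC>
  for \<Gamma> :: "('g, 'p) monoid_scheme" and \<CC> :: "('o, 'm) cat" +
  fixes rep :: "'o \<Rightarrow> 'w set \<times> ('g \<Rightarrow> 'w \<Rightarrow> 'w)"
    and fn :: "'m \<Rightarrow> 'w \<Rightarrow> 'w"
  assumes rep_perm_reps: "A \<in> Obj \<CC> \<Longrightarrow> rep A \<in> perm_reps \<Gamma>"
    and rep_ess_surj: "(R :: 'w set \<times> ('g \<Rightarrow> 'w \<Rightarrow> 'w)) \<in> perm_reps \<Gamma> \<Longrightarrow>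
      \<exists>A \<in> Obj \<CC>. \<exists>f \<in> equivariant_maps \<Gamma> (rep A) R. bij_betw f (fst (rep A)) (fst R)"
    and fn_bij: "\<lbrakk>A \<in> Obj \<CC>; B \<in> Obj \<CC>\<rbrakk>
      \<Longrightarrow> bij_betw fn (Hom \<CC> A B) (equivariant_maps \<Gamma> (rep A) (rep B))"
    and fn_ident: "A \<in> Obj \<CC> \<Longrightarrow> fn (ident \<CC> A) = (\<lambda>x \<in> fst (rep A). x)"
    and fn_comp: "\<lbrakk>f \<in> Hom \<CC> A B; g \<in> Hom \<CC> B D\<rbrakk>
      \<Longrightarrow> fn (comp \<CC> f g) = compose (fst (rep A)) (fn g) (fn f)"

definition monodromy_group ::
    "('g, 'p) monoid_scheme \<Rightarrow> 'w set \<Rightarrow> ('g \<Rightarrow> 'w \<Rightarrow> 'w) \<Rightarrow> ('w \<Rightarrow> 'w) monoid"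
  where "monodromy_group \<Gamma> \<Omega> \<theta> = (Sym \<Omega>)\<lparr>carrier := \<theta> ` carrier \<Gamma>\<rparr>"

definition connected_rep :: "('g, 'p) monoid_scheme \<Rightarrow> 'w set \<Rightarrow> ('g \<Rightarrow> 'w \<Rightarrow> 'w) \<Rightarrow> bool"
  where "connected_rep \<Gamma> \<Omega> \<theta> \<longleftrightarrow> \<Omega> \<noteq> {} \<and> (\<forall>x \<in> \<Omega>. orbit \<Gamma> \<theta> x = \<Omega>)"

text \<open>\<open>N\<^sub>X(Y) / Y\<close>\<close>

definition normalizer_quotient :: "('a, 'b) monoid_scheme \<Rightarrow> 'a set \<Rightarrow> 'a set monoid"
  where "normalizer_quotient X Y = (X\<lparr>carrier := normalizer X Y\<rparr>) Mod Y"


text \<open>The identification takes the automorphism group of an object onto the centraliser of its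
  monodromy group in the symmetric group.\<close>

definition centraliser :: "('a, 'b) monoid_scheme \<Rightarrow> 'a set \<Rightarrow> 'a set"
  where "centraliser X Y = {x \<in> carrier X. \<forall>y \<in> Y. x \<otimes>\<^bsub>X\<^esub> y = y \<otimes>\<^bsub>X\<^esub> x}"

lemma carrier_Sym: "carrier (Sym \<Omega>) = Bij \<Omega>"
  by (simp add: Sym_def BijGroup_def)

lemma one_Sym: "\<one>\<^bsub>Sym \<Omega>\<^esub> = (\<lambda>x \<in> \<Omega>. x)"
  by (simp add: Sym_def BijGroup_def)

lemma mult_Sym: "\<lbrakk>f \<in> Bij \<Omega>; g \<in> Bij \<Omega>\<rbrakk> \<Longrightarrow> f \<otimes>\<^bsub>Sym \<Omega>\<^esub> g = compose \<Omega> g f"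
  by (simp add: Sym_def BijGroup_def)

lemma group_Sym: "group (Sym \<Omega>)"
proof (rule groupI)
  fix x y z assume "x \<in> carrier (Sym \<Omega>)" "y \<in> carrier (Sym \<Omega>)" "z \<in> carrier (Sym \<Omega>)"
  then show "x \<otimes>\<^bsub>Sym \<Omega>\<^esub> y \<otimes>\<^bsub>Sym \<Omega>\<^esub> z = x \<otimes>\<^bsub>Sym \<Omega>\<^esub> (y \<otimes>\<^bsub>Sym \<Omega>\<^esub> z)"
    by (simp add: carrier_Sym mult_Sym compose_Bij Bij_imp_funcset compose_assoc)
next
  fix x assume x: "x \<in> carrier (Sym \<Omega>)"
  then have "restrict (inv_into \<Omega> x) \<Omega> \<in> Bij \<Omega>"
    by (simp add: carrier_Sym restrict_inv_into_Bij)
  moreover have "compose \<Omega> x (restrict (inv_into \<Omega> x) \<Omega>) = (\<lambda>x \<in> \<Omega>. x)"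
    using x by (auto simp: carrier_Sym Bij_def bij_betw_def compose_def fun_eq_iff f_inv_into_f)
  ultimately show "\<exists>y \<in> carrier (Sym \<Omega>). y \<otimes>\<^bsub>Sym \<Omega>\<^esub> x = \<one>\<^bsub>Sym \<Omega>\<^esub>"
    using x by (auto simp: carrier_Sym mult_Sym one_Sym)
qed (auto simp: carrier_Sym mult_Sym one_Sym compose_Bij id_Bij
    compose_Id[OF Bij_imp_funcset Bij_imp_extensional])

lemma Bij_inverse:
  assumes "f \<in> \<Omega> \<rightarrow>\<^sub>E \<Omega>" "g \<in> \<Omega> \<rightarrow>\<^sub>E \<Omega>"
    and "compose \<Omega> f g = (\<lambda>x \<in> \<Omega>. x)" "compose \<Omega> g f = (\<lambda>x \<in> \<Omega>. x)"
  shows "f \<in> Bij \<Omega>"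
proof -
  have "f (g x) = x" "g (f x) = x" if "x \<in> \<Omega>" for x
    using assms(3,4)[THEN fun_cong, of x] that by (simp_all add: compose_def)
  then have "bij_betw f \<Omega> \<Omega>"
    using assms(1,2) by (intro bij_betw_byWitness[where f' = g]) auto
  with assms(1) show ?thesis by (auto simp: Bij_def PiE_def)
qed

lemma centraliser_eq:
  assumes "\<theta> \<in> hom \<Gamma> (Sym \<Omega>)"
  shows "centraliser (Sym \<Omega>) (\<theta> ` carrier \<Gamma>) = Bij \<Omega> \<inter> equivariant_maps \<Gamma> (\<Omega>, \<theta>) (\<Omega>, \<theta>)"
proof -
  have \<theta>: "\<theta> \<gamma> \<in> Bij \<Omega>" if "\<gamma> \<in> carrier \<Gamma>" for \<gamma>
    using assms that by (auto simp: hom_def carrier_Sym)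
  have "f \<otimes>\<^bsub>Sym \<Omega>\<^esub> \<theta> \<gamma> = \<theta> \<gamma> \<otimes>\<^bsub>Sym \<Omega>\<^esub> f \<longleftrightarrow> (\<forall>x \<in> \<Omega>. f (\<theta> \<gamma> x) = \<theta> \<gamma> (f x))"
    if "f \<in> Bij \<Omega>" "\<gamma> \<in> carrier \<Gamma>" for f \<gamma>
    using that \<theta> by (auto simp: mult_Sym compose_def fun_eq_iff restrict_def)
  then show ?thesis
    by (auto simp: centraliser_def carrier_Sym PiE_def Bij_imp_extensional
        dest: Bij_imp_funcset)
qed

lemma (in permutational_category) Aut_iso_centraliser:
  assumes A: "A \<in> Obj \<CC>" and R: "rep A = (\<Omega>, \<theta>)"
  shows "fn \<in> iso (Aut \<CC> A)
    ((Sym \<Omega>)\<lparr>carrier := centraliser (Sym \<Omega>) (carrier (monodromy_group \<Gamma> \<Omega> \<theta>))\<rparr>)"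
proof -
  let ?E = "equivariant_maps \<Gamma> (\<Omega>, \<theta>) (\<Omega>, \<theta>)"
  have \<theta>: "\<theta> \<in> hom \<Gamma> (Sym \<Omega>)"
    using rep_perm_reps[OF A] R by (simp add: perm_reps_def)
  have \<theta>B: "\<theta> \<gamma> \<in> Bij \<Omega>" if "\<gamma> \<in> carrier \<Gamma>" for \<gamma>
    using \<theta> that by (auto simp: hom_def carrier_Sym)
  have bij: "bij_betw fn (Hom \<CC> A A) ?E"
    using fn_bij[OF A A] R by simp
  have fn_c: "fn (comp \<CC> f g) = compose \<Omega> (fn g) (fn f)"
    if "f \<in> Hom \<CC> A A" "g \<in> Hom \<CC> A A" for f g
    using fn_comp[OF that] R by simp
  have fn_i: "fn (ident \<CC> A) = (\<lambda>x \<in> \<Omega>. x)"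
    using fn_ident[OF A] R by simp
  have carrier: "carrier (Aut \<CC> A) = {f \<in> Hom \<CC> A A. fn f \<in> Bij \<Omega>}" (is "?L = ?R")
  proof
    show "?L \<subseteq> ?R"
    proof
      fix f assume "f \<in> ?L"
      then obtain g where f: "f \<in> Hom \<CC> A A" and g: "g \<in> Hom \<CC> A A"
        and gf: "comp \<CC> g f = ident \<CC> A" "comp \<CC> f g = ident \<CC> A"
        by (auto simp: Aut_def units_of_def Units_def End_monoid_def)
      have "fn f \<in> ?E" "fn g \<in> ?E"
        using bij f g by (auto simp: bij_betw_def)
      then have "fn f \<in> Bij \<Omega>"
        using fn_c[OF f g] fn_c[OF g f] gf fn_i by (intro Bij_inverse[of _ _ "fn g"]) auto
      with f show "f \<in> ?R" by simp
    qed
    show "?R \<subseteq> ?L"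
    proof
      fix f assume "f \<in> ?R"
      then have f: "f \<in> Hom \<CC> A A" and fB: "fn f \<in> Bij \<Omega>" by auto
      have fE: "fn f \<in> ?E" using bij f by (auto simp: bij_betw_def)
      define h where "h = restrict (inv_into \<Omega> (fn f)) \<Omega>"
      have b: "inj_on (fn f) \<Omega>" "fn f ` \<Omega> = \<Omega>"
        using fB by (auto simp: Bij_def bij_betw_def)
      have hB: "h \<in> Bij \<Omega>"
        unfolding h_def by (rule restrict_inv_into_Bij[OF fB])
      have hf: "h (fn f x) = x" "fn f (h x) = x" "h x \<in> \<Omega>" if "x \<in> \<Omega>" for x
        using that b by (auto simp: h_def f_inv_into_f inv_into_into)
      have "h (\<theta> \<gamma> x) = \<theta> \<gamma> (h x)" if g: "\<gamma> \<in> carrier \<Gamma>" and x: "x \<in> \<Omega>" for \<gamma> x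
      proof -
        have t: "\<theta> \<gamma> (h x) \<in> \<Omega>"
          using \<theta>B[OF g] hf(3)[OF x] by (auto dest: Bij_imp_funcset)
        have "fn f (\<theta> \<gamma> (h x)) = \<theta> \<gamma> x"
          using fE g hf[OF x] by auto
        then show ?thesis using hf(1)[OF t] by simp
      qed
      then have "h \<in> ?E"
        using hf(3) by (auto simp: h_def)
      then obtain g where g: "g \<in> Hom \<CC> A A" and gh: "fn g = h"
        using bij unfolding bij_betw_def by (metis imageE)
      have id: "ident \<CC> A \<in> Hom \<CC> A A" by (rule ident_Hom[OF A])
      have "fn (comp \<CC> g f) = fn (ident \<CC> A)" "fn (comp \<CC> f g) = fn (ident \<CC> A)"
        using hf by (auto simp: fn_c[OF f g] fn_c[OF g f] fn_i gh compose_def fun_eq_iff)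
      then have "comp \<CC> g f = ident \<CC> A" "comp \<CC> f g = ident \<CC> A"
        using bij comp_Hom[OF f g] comp_Hom[OF g f] id by (auto simp: bij_betw_def inj_on_def)
      with f g show "f \<in> ?L"
        by (auto simp: Aut_def units_of_def Units_def End_monoid_def)
    qed
  qed
  have "bij_betw fn (carrier (Aut \<CC> A)) (Bij \<Omega> \<inter> ?E)"
  proof -
    have "fn ` {f \<in> Hom \<CC> A A. fn f \<in> Bij \<Omega>} = Bij \<Omega> \<inter> fn ` Hom \<CC> A A"
      by blast
    moreover have "inj_on fn {f \<in> Hom \<CC> A A. fn f \<in> Bij \<Omega>}"
      by (rule inj_on_subset[OF bij_betw_imp_inj_on[OF bij]]) blast
    ultimately show ?thesis
      unfolding carrier bij_betw_def bij_betw_imp_surj_on[OF bij] by blast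
  qed
  moreover have "fn (f \<otimes>\<^bsub>Aut \<CC> A\<^esub> g) = fn f \<otimes>\<^bsub>Sym \<Omega>\<^esub> fn g"
    if "f \<in> carrier (Aut \<CC> A)" "g \<in> carrier (Aut \<CC> A)" for f g
    using that fn_c[of f g] unfolding carrier
    by (simp add: mult_Sym) (simp add: Aut_def units_of_def End_monoid_def)
  ultimately show ?thesis
    by (auto simp: iso_def hom_def monodromy_group_def centraliser_eq[OF \<theta>] dest: bij_betwE)
qed


text \<open>The permutation representations themselves, with the equivariant functions between them, form
  a permutational category.\<close>

definition rep_category ::
    "('g, 'p) monoid_scheme \<Rightarrow> ('w set \<times> ('g \<Rightarrow> 'w \<Rightarrow> 'w),
      ('w set \<times> ('g \<Rightarrow> 'w \<Rightarrow> 'w)) \<times> ('w \<Rightarrow> 'w) \<times> ('w set \<times> ('g \<Rightarrow> 'w \<Rightarrow> 'w))) cat"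
  where "rep_category \<Gamma> =
    \<lparr>Obj = perm_reps \<Gamma>,
     Mor = {(A, f, B). A \<in> perm_reps \<Gamma> \<and> B \<in> perm_reps \<Gamma> \<and> f \<in> equivariant_maps \<Gamma> A B},
     source = (\<lambda>(A, f, B). A),
     target = (\<lambda>(A, f, B). B),
     ident = (\<lambda>A. (A, \<lambda>x \<in> fst A. x, A)),
     comp = (\<lambda>(A, f, B) (B', g, D). (A, compose (fst A) g f, D))\<rparr>"

lemma perm_reps_closed:
  assumes "(\<Omega>, \<theta>) \<in> perm_reps \<Gamma>" "\<gamma> \<in> carrier \<Gamma>" "x \<in> \<Omega>"
  shows "\<theta> \<gamma> x \<in> \<Omega>"
proof -
  have "\<theta> \<gamma> \<in> Bij \<Omega>"
    using assms by (auto simp: perm_reps_def hom_def carrier_Sym)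
  with assms(3) show ?thesis by (auto dest: Bij_imp_funcset)
qed

lemma equivariant_id:
  assumes "A \<in> perm_reps \<Gamma>"
  shows "(\<lambda>x \<in> fst A. x) \<in> equivariant_maps \<Gamma> A A"
  using assms by (cases A) (auto simp: perm_reps_closed)

lemma equivariant_compose:
  assumes "A \<in> perm_reps \<Gamma>" "f \<in> equivariant_maps \<Gamma> A B" "g \<in> equivariant_maps \<Gamma> B D"
  shows "compose (fst A) g f \<in> equivariant_maps \<Gamma> A D"
  using assms
  by (cases A; cases B; cases D) (auto simp: perm_reps_closed compose_def PiE_def Pi_def)

lemma equivariant_PiE: "f \<in> equivariant_maps \<Gamma> A B \<Longrightarrow> f \<in> fst A \<rightarrow>\<^sub>E fst B"
  by (cases A; cases B) auto

lemma permutational_category_rep_category: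
  fixes \<Gamma> :: "('g, 'p) monoid_scheme"
  assumes "group \<Gamma>"
  shows "permutational_category \<Gamma> (rep_category \<Gamma>)
    (\<lambda>R :: 'w set \<times> ('g \<Rightarrow> 'w \<Rightarrow> 'w). R) (\<lambda>(A, f, B). f)"
proof -
  have Hom: "Hom (rep_category \<Gamma>) A B =
      (if A \<in> perm_reps \<Gamma> \<and> B \<in> perm_reps \<Gamma> then (\<lambda>f. (A, f, B)) ` equivariant_maps \<Gamma> A B else {})"
    for A B :: "'w set \<times> ('g \<Rightarrow> 'w \<Rightarrow> 'w)"
    by (auto simp: Hom_def rep_category_def)
  have C: "Obj (rep_category \<Gamma>) = perm_reps \<Gamma>"
    "comp (rep_category \<Gamma>) (A, f, B) (B', g, D) = (A, compose (fst A) g f, D)"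
    "ident (rep_category \<Gamma>) A = (A, \<lambda>x \<in> fst A. x, A)"
    for A B B' D :: "'w set \<times> ('g \<Rightarrow> 'w \<Rightarrow> 'w)" and f g
    by (simp_all add: rep_category_def)
  interpret group \<Gamma> by fact
  show ?thesis
  proof unfold_locales
    fix A B D E :: "'w set \<times> ('g \<Rightarrow> 'w \<Rightarrow> 'w)" and f g h
    assume f: "f \<in> Hom (rep_category \<Gamma>) A B" and g: "g \<in> Hom (rep_category \<Gamma>) B D"
      and h: "h \<in> Hom (rep_category \<Gamma>) D E"
    obtain f' g' where fg: "f = (A, f', B)" "f' \<in> fst A \<rightarrow>\<^sub>E fst B" "g = (B, g', D)"
      using f g by (auto simp: Hom split: if_splits dest: equivariant_PiE)
    obtain h' where h': "h = (D, h', E)"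
      using h by (auto simp: Hom split: if_splits)
    show "comp (rep_category \<Gamma>) (comp (rep_category \<Gamma>) f g) h =
      comp (rep_category \<Gamma>) f (comp (rep_category \<Gamma>) g h)"
      using h' fg by (auto simp: C compose_def fun_eq_iff)
  next
    fix R :: "'w set \<times> ('g \<Rightarrow> 'w \<Rightarrow> 'w)" assume R: "R \<in> perm_reps \<Gamma>"
    show "\<exists>A \<in> (Obj (rep_category \<Gamma>) :: ('w set \<times> ('g \<Rightarrow> 'w \<Rightarrow> 'w)) set).
        \<exists>f \<in> equivariant_maps \<Gamma> A R. bij_betw f (fst A) (fst R)"
    proof (rule bexI[where x = R], rule bexI[where x = "\<lambda>x \<in> fst R. x"])
      show "bij_betw (\<lambda>x \<in> fst R. x) (fst R) (fst R)"
        by (auto simp: bij_betw_def inj_on_def)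
    qed (use R equivariant_id[OF R] in \<open>simp_all add: C\<close>)
  next
    fix A B :: "'w set \<times> ('g \<Rightarrow> 'w \<Rightarrow> 'w)"
    assume "A \<in> Obj (rep_category \<Gamma>)" "B \<in> Obj (rep_category \<Gamma>)"
    then show "bij_betw (\<lambda>(A, f, B). f) (Hom (rep_category \<Gamma>) A B) (equivariant_maps \<Gamma> A B)"
      unfolding Hom by (auto simp: C bij_betw_def inj_on_def image_image)
  next
    fix A B D :: "'w set \<times> ('g \<Rightarrow> 'w \<Rightarrow> 'w)" and f g
    assume "f \<in> Hom (rep_category \<Gamma>) A B" "g \<in> Hom (rep_category \<Gamma>) B D"
    then show "comp (rep_category \<Gamma>) f g \<in> Hom (rep_category \<Gamma>) A D"
      by (auto simp: Hom C equivariant_compose split: if_splits)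
  next
    fix A B :: "'w set \<times> ('g \<Rightarrow> 'w \<Rightarrow> 'w)" and f
    assume "f \<in> Hom (rep_category \<Gamma>) A B"
    then obtain f' where "f = (A, f', B)" "f' \<in> fst A \<rightarrow>\<^sub>E fst B"
      by (auto simp: Hom split: if_splits dest: equivariant_PiE)
    then show "comp (rep_category \<Gamma>) (ident (rep_category \<Gamma>) A) f = f"
      and "comp (rep_category \<Gamma>) f (ident (rep_category \<Gamma>) B) = f"
      by (auto simp: C PiE_def)
  next
    fix A :: "'w set \<times> ('g \<Rightarrow> 'w \<Rightarrow> 'w)" assume "A \<in> Obj (rep_category \<Gamma>)"
    then show "ident (rep_category \<Gamma>) A \<in> Hom (rep_category \<Gamma>) A A"
      by (simp add: Hom C equivariant_id)
  next
    fix A B D :: "'w set \<times> ('g \<Rightarrow> 'w \<Rightarrow> 'w)" and f g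
    assume "f \<in> Hom (rep_category \<Gamma>) A B" "g \<in> Hom (rep_category \<Gamma>) B D"
    then show "(case comp (rep_category \<Gamma>) f g of (A, f, B) \<Rightarrow> f) =
        compose (fst A) (case g of (A, f, B) \<Rightarrow> f) (case f of (A, f, B) \<Rightarrow> f)"
      by (auto simp: Hom C split: if_splits)
  qed (auto simp: rep_category_def)
qed

end

theory Submission
  imports Defs
begin

text \<open>
  An equivariant map out of a connected representation is determined by the image \<open>\<beta>\<close> of the single
  point \<open>\<alpha>\<close>, and the possible \<open>\<beta>\<close> are those fixed by all of \<open>M = \<Gamma>\<^sub>\<alpha>\<close>. Such a map from \<open>\<Omega>\<close> to
  itself is a permutation exactly when \<open>\<beta>\<close> has the same stabiliser as \<open>\<alpha>\<close>. With permutations acting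
  on the right, and \<open>\<beta>\<close> written as \<open>\<alpha> n\<inverse>\<close>, the stabiliser of \<open>\<beta>\<close> is \<open>n M n\<inverse>\<close>; so the
  permutations centralising the action correspond to the elements \<open>n\<close> of \<open>N\<^sub>\<Gamma>(M)\<close>.
  Let \<open>c\<^sub>n\<close> be the permutation with \<open>\<alpha> c\<^sub>n = \<alpha> n\<inverse>\<close>. Then
  \<open>\<alpha> c\<^sub>n c\<^sub>m = (\<alpha> n\<inverse>) c\<^sub>m = (\<alpha> c\<^sub>m) n\<inverse> = \<alpha> m\<inverse> n\<inverse> = \<alpha> (n m)\<inverse>\<close>,
  so \<open>n \<mapsto> c\<^sub>n\<close> is a homomorphism; the inverse is what compensates for the centralising
  permutation commuting past the action. It is onto the centraliser, and its kernel is \<open>M\<close>, so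
  \<open>N\<^sub>\<Gamma>(M) / M\<close> is isomorphic to the centraliser (\<open>centraliser_iso_normalizer_quotient\<close>).

  The monodromy group \<open>G\<close> acts on \<open>\<Omega>\<close> by the identity representation, which is connected and has
  the same image in the symmetric group as \<open>\<theta>\<close>. The same lemma applied to \<open>G\<close> therefore describes the
  same centraliser, as \<open>N\<^sub>G(H) / H\<close>, and the two quotients are compared through the centraliser,
  which is the automorphism group by \<open>Aut_iso_centraliser\<close>.
\<close>

section \<open>Permutation representations acting on the right\<close>

lemma perm_rep_Bij: "\<theta> \<in> hom \<Gamma> (Sym \<Omega>) \<Longrightarrow> g \<in> carrier \<Gamma> \<Longrightarrow> \<theta> g \<in> Bij \<Omega>"
  by (auto simp: hom_def carrier_Sym)

lemma perm_rep_closed: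
  "\<theta> \<in> hom \<Gamma> (Sym \<Omega>) \<Longrightarrow> g \<in> carrier \<Gamma> \<Longrightarrow> x \<in> \<Omega> \<Longrightarrow> \<theta> g x \<in> \<Omega>"
  by (rule funcset_mem[OF Bij_imp_funcset[OF perm_rep_Bij]])

lemma perm_rep_mult:
  assumes "\<theta> \<in> hom \<Gamma> (Sym \<Omega>)" "g \<in> carrier \<Gamma>" "h \<in> carrier \<Gamma>" "x \<in> \<Omega>"
  shows "\<theta> (g \<otimes>\<^bsub>\<Gamma>\<^esub> h) x = \<theta> h (\<theta> g x)"
  using assms perm_rep_Bij[OF assms(1)]
  by (simp add: hom_mult[OF assms(1)] mult_Sym compose_def)

lemma perm_rep_one:
  assumes "group \<Gamma>" "\<theta> \<in> hom \<Gamma> (Sym \<Omega>)" "x \<in> \<Omega>"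
  shows "\<theta> \<one>\<^bsub>\<Gamma>\<^esub> x = x"
  using hom_one[OF assms(2,1) group_Sym] assms(3) by (simp add: one_Sym)

lemma perm_rep_inv:
  fixes \<Gamma> (structure)
  assumes "group \<Gamma>" "\<theta> \<in> hom \<Gamma> (Sym \<Omega>)" "g \<in> carrier \<Gamma>" "x \<in> \<Omega>"
  shows "\<theta> (inv\<^bsub>\<Gamma>\<^esub> g) (\<theta> g x) = x" and "\<theta> g (\<theta> (inv\<^bsub>\<Gamma>\<^esub> g) x) = x"
proof -
  interpret group \<Gamma> by fact
  show "\<theta> (inv g) (\<theta> g x) = x" "\<theta> g (\<theta> (inv g) x) = x"
    using assms perm_rep_mult[OF assms(2), of g "inv g" x] perm_rep_mult[OF assms(2), of "inv g" g x]
    by (simp_all add: perm_rep_one)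
qed

lemma connected_rep_obtain:
  assumes "connected_rep \<Gamma> \<Omega> \<theta>" "\<alpha> \<in> \<Omega>" "x \<in> \<Omega>"
  obtains g where "g \<in> carrier \<Gamma>" "x = \<theta> g \<alpha>"
  using assms unfolding connected_rep_def orbit_def by blast

text \<open>The point \<open>x\<close> is moved by \<open>n\<inverse>\<close>, not by \<open>n\<close>: for a right action this is what conjugates the
  stabiliser in the direction used by \<^const>\<open>normalizer\<close>.\<close>

lemma stabilizer_conjugate:
  fixes \<Gamma> (structure)
  assumes "group \<Gamma>" "\<theta> \<in> hom \<Gamma> (Sym \<Omega>)" "n \<in> carrier \<Gamma>" "x \<in> \<Omega>"
  shows "stabilizer \<Gamma> \<theta> (\<theta> (inv\<^bsub>\<Gamma>\<^esub> n) x) = n <#\<^bsub>\<Gamma>\<^esub> stabilizer \<Gamma> \<theta> x #>\<^bsub>\<Gamma>\<^esub> inv\<^bsub>\<Gamma>\<^esub> n"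
proof -
  interpret group \<Gamma> by fact
  note act = perm_rep_mult[OF assms(2)] perm_rep_inv[OF assms(1,2)] perm_rep_closed[OF assms(2)]
  show ?thesis
  proof (intro equalityI subsetI)
    fix g assume "g \<in> stabilizer \<Gamma> \<theta> (\<theta> (inv n) x)"
    then have g: "g \<in> carrier \<Gamma>" "\<theta> g (\<theta> (inv n) x) = \<theta> (inv n) x"
      by (auto simp: stabilizer_def)
    have "inv n \<otimes> g \<otimes> n \<in> stabilizer \<Gamma> \<theta> x"
      using g assms(3,4) by (simp add: stabilizer_def act)
    moreover have "g = n \<otimes> (inv n \<otimes> g \<otimes> n) \<otimes> inv n"
      using g(1) assms(3) by (simp flip: m_assoc) (simp add: m_assoc)
    ultimately show "g \<in> n <# stabilizer \<Gamma> \<theta> x #> inv n"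
      unfolding l_coset_def r_coset_def by blast
  next
    fix g assume "g \<in> n <# stabilizer \<Gamma> \<theta> x #> inv n"
    then obtain m where "m \<in> carrier \<Gamma>" "\<theta> m x = x" "g = n \<otimes> m \<otimes> inv n"
      by (auto simp: l_coset_def r_coset_def stabilizer_def)
    then show "g \<in> stabilizer \<Gamma> \<theta> (\<theta> (inv n) x)"
      using assms(3,4) by (simp add: stabilizer_def act)
  qed
qed

lemma mem_normalizer_stabilizer_iff:
  assumes "group \<Gamma>" "\<theta> \<in> hom \<Gamma> (Sym \<Omega>)" "\<alpha> \<in> \<Omega>"
  shows "n \<in> normalizer \<Gamma> (stabilizer \<Gamma> \<theta> \<alpha>) \<longleftrightarrow>
    n \<in> carrier \<Gamma> \<and> stabilizer \<Gamma> \<theta> (\<theta> (inv\<^bsub>\<Gamma>\<^esub> n) \<alpha>) = stabilizer \<Gamma> \<theta> \<alpha>"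
proof -
  have "stabilizer \<Gamma> \<theta> \<alpha> \<subseteq> carrier \<Gamma>"
    by (auto simp: stabilizer_def)
  then have "n \<in> normalizer \<Gamma> (stabilizer \<Gamma> \<theta> \<alpha>) \<longleftrightarrow> n \<in> carrier \<Gamma> \<and>
      n <#\<^bsub>\<Gamma>\<^esub> stabilizer \<Gamma> \<theta> \<alpha> #>\<^bsub>\<Gamma>\<^esub> inv\<^bsub>\<Gamma>\<^esub> n = stabilizer \<Gamma> \<theta> \<alpha>"
    unfolding normalizer_def by (subst stabilizer_def) simp
  then show ?thesis
    using stabilizer_conjugate[OF assms(1,2) _ assms(3)] by auto
qed

section \<open>Equivariant maps out of a connected representation\<close>

lemma equivariant_maps_eqI:
  assumes "connected_rep \<Gamma> \<Omega> \<theta>" "\<alpha> \<in> \<Omega>"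
    and "c \<in> equivariant_maps \<Gamma> (\<Omega>, \<theta>) (\<Delta>, \<eta>)" "d \<in> equivariant_maps \<Gamma> (\<Omega>, \<theta>) (\<Delta>, \<eta>)"
    and "c \<alpha> = d \<alpha>"
  shows "c = d"
proof (rule PiE_ext)
  show "c \<in> \<Omega> \<rightarrow>\<^sub>E \<Delta>" "d \<in> \<Omega> \<rightarrow>\<^sub>E \<Delta>"
    using assms by auto
  fix x assume "x \<in> \<Omega>"
  then obtain g where "g \<in> carrier \<Gamma>" "x = \<theta> g \<alpha>"
    using connected_rep_obtain assms(1,2) by metis
  then show "c x = d x"
    using assms by simp
qed

text \<open>The map sends \<open>\<alpha> g\<close> to \<open>\<beta> g\<close>. If \<open>\<alpha> g = \<alpha> h\<close>, then \<open>g h\<inverse>\<close> fixes \<open>\<alpha>\<close>, hence also \<open>\<beta>\<close>, so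
  \<open>\<beta> g = \<beta> h\<close>.\<close>

lemma equivariant_map_exists:
  fixes \<Gamma> (structure)
  assumes \<Gamma>: "group \<Gamma>" and \<theta>: "\<theta> \<in> hom \<Gamma> (Sym \<Omega>)" and \<eta>: "\<eta> \<in> hom \<Gamma> (Sym \<Delta>)"
    and conn: "connected_rep \<Gamma> \<Omega> \<theta>" and \<alpha>: "\<alpha> \<in> \<Omega>" and \<beta>: "\<beta> \<in> \<Delta>"
    and stab: "stabilizer \<Gamma> \<theta> \<alpha> \<subseteq> stabilizer \<Gamma> \<eta> \<beta>"
  obtains c where "c \<in> equivariant_maps \<Gamma> (\<Omega>, \<theta>) (\<Delta>, \<eta>)" "c \<alpha> = \<beta>"
proof -
  interpret group \<Gamma> by fact
  have wd: "\<eta> g \<beta> = \<eta> h \<beta>" if g: "g \<in> carrier \<Gamma>" and h: "h \<in> carrier \<Gamma>" and eq: "\<theta> g \<alpha> = \<theta> h \<alpha>"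
    for g h
  proof -
    have "g \<otimes> inv h \<in> stabilizer \<Gamma> \<theta> \<alpha>"
      using g h eq \<alpha> by (simp add: stabilizer_def perm_rep_mult[OF \<theta>] perm_rep_inv[OF \<Gamma> \<theta>])
    then have "g \<otimes> inv h \<in> stabilizer \<Gamma> \<eta> \<beta>"
      using stab by blast
    then have "\<eta> (inv h) (\<eta> g \<beta>) = \<beta>"
      using g h \<beta> by (simp add: stabilizer_def perm_rep_mult[OF \<eta>])
    then show ?thesis
      using perm_rep_inv(2)[OF \<Gamma> \<eta> h perm_rep_closed[OF \<eta> g \<beta>]] by simp
  qed
  define k where "k x = (SOME g. g \<in> carrier \<Gamma> \<and> x = \<theta> g \<alpha>)" for x
  have k: "k x \<in> carrier \<Gamma> \<and> x = \<theta> (k x) \<alpha>" if "x \<in> \<Omega>" for x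
    unfolding k_def by (rule someI_ex) (use connected_rep_obtain[OF conn \<alpha> that] in metis)
  define c where "c = (\<lambda>x \<in> \<Omega>. \<eta> (k x) \<beta>)"
  have c: "c (\<theta> g \<alpha>) = \<eta> g \<beta>" if "g \<in> carrier \<Gamma>" for g
    using wd[OF _ that, of "k (\<theta> g \<alpha>)"] k[of "\<theta> g \<alpha>"] perm_rep_closed[OF \<theta> that \<alpha>]
    by (simp add: c_def)
  have "c (\<theta> g x) = \<eta> g (c x)" if g: "g \<in> carrier \<Gamma>" and x: "x \<in> \<Omega>" for g x
  proof -
    obtain h where h: "h \<in> carrier \<Gamma>" "x = \<theta> h \<alpha>"
      using connected_rep_obtain[OF conn \<alpha> x] .
    then have "c (\<theta> g x) = c (\<theta> (h \<otimes> g) \<alpha>)"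
      using g \<alpha> by (simp add: perm_rep_mult[OF \<theta>])
    then show ?thesis
      using g h \<beta> by (simp add: c perm_rep_mult[OF \<eta>])
  qed
  moreover have "c \<in> \<Omega> \<rightarrow>\<^sub>E \<Delta>"
    using k \<beta> by (auto simp: c_def intro!: perm_rep_closed[OF \<eta>])
  moreover have "c \<alpha> = \<beta>"
    using c[OF one_closed] \<alpha> \<beta> by (simp add: perm_rep_one[OF \<Gamma> \<theta>] perm_rep_one[OF \<Gamma> \<eta>])
  ultimately show thesis
    by (intro that[of c]) auto
qed

section \<open>The centraliser of a connected representation\<close>

lemma subgroup_centraliser:
  fixes X (structure)
  assumes "group X" "Y \<subseteq> carrier X"
  shows "subgroup (centraliser X Y) X"
proof -
  interpret group X by fact
  show ?thesis
  proof
    fix a b assume "a \<in> centraliser X Y" "b \<in> centraliser X Y"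
    then show "a \<otimes> b \<in> centraliser X Y"
      using assms(2) by (auto simp: centraliser_def subset_eq) (metis m_assoc)
  next
    fix a assume "a \<in> centraliser X Y"
    then have a: "a \<in> carrier X" "\<And>y. y \<in> Y \<Longrightarrow> a \<otimes> y = y \<otimes> a"
      by (auto simp: centraliser_def)
    have "inv a \<otimes> y = y \<otimes> inv a" if "y \<in> Y" for y
    proof -
      have y: "y \<in> carrier X" using that assms(2) by blast
      have "inv a \<otimes> y = inv a \<otimes> (y \<otimes> a) \<otimes> inv a"
        using a(1) y by (simp add: m_assoc)
      also have "\<dots> = inv a \<otimes> (a \<otimes> y) \<otimes> inv a"
        by (simp add: a(2)[OF that])
      also have "\<dots> = y \<otimes> inv a"
        using a(1) y by (simp flip: m_assoc)
      finally show ?thesis .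
    qed
    then show "inv a \<in> centraliser X Y"
      using a(1) by (simp add: centraliser_def)
  qed (use assms(2) in \<open>auto simp: centraliser_def\<close>)
qed

text \<open>Two equivariant maps \<open>c\<close> and \<open>d\<close>, one taking \<open>\<alpha>\<close> to \<open>\<beta>\<close> and the other taking \<open>\<beta>\<close> back to
  \<open>\<alpha>\<close>, are mutually inverse, because each composite fixes a point.\<close>

lemma centraliser_elem_exists:
  assumes \<Gamma>: "group \<Gamma>" and \<theta>: "\<theta> \<in> hom \<Gamma> (Sym \<Omega>)" and conn: "connected_rep \<Gamma> \<Omega> \<theta>"
    and \<alpha>: "\<alpha> \<in> \<Omega>" and \<beta>: "\<beta> \<in> \<Omega>" and stab: "stabilizer \<Gamma> \<theta> \<alpha> = stabilizer \<Gamma> \<theta> \<beta>"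
  obtains c where "c \<in> centraliser (Sym \<Omega>) (\<theta> ` carrier \<Gamma>)" "c \<alpha> = \<beta>"
proof -
  let ?R = "(\<Omega>, \<theta>)"
  obtain c where c: "c \<in> equivariant_maps \<Gamma> ?R ?R" "c \<alpha> = \<beta>"
    by (rule equivariant_map_exists[OF \<Gamma> \<theta> \<theta> conn \<alpha> \<beta>]) (simp_all add: stab)
  obtain d where d: "d \<in> equivariant_maps \<Gamma> ?R ?R" "d \<beta> = \<alpha>"
    by (rule equivariant_map_exists[OF \<Gamma> \<theta> \<theta> conn \<beta> \<alpha>]) (simp_all add: stab)
  have R: "?R \<in> perm_reps \<Gamma>"
    using \<theta> by (simp add: perm_reps_def)
  have E: "compose \<Omega> c d \<in> equivariant_maps \<Gamma> ?R ?R" "compose \<Omega> d c \<in> equivariant_maps \<Gamma> ?R ?R"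
    "(\<lambda>x \<in> \<Omega>. x) \<in> equivariant_maps \<Gamma> ?R ?R"
    using equivariant_compose[OF R d(1) c(1)] equivariant_compose[OF R c(1) d(1)]
      equivariant_id[OF R] by (simp_all del: equivariant_maps.simps)
  have "compose \<Omega> c d = (\<lambda>x \<in> \<Omega>. x)"
    by (rule equivariant_maps_eqI[OF conn \<beta> E(1,3)]) (use c d \<beta> in \<open>simp add: compose_def\<close>)
  moreover have "compose \<Omega> d c = (\<lambda>x \<in> \<Omega>. x)"
    by (rule equivariant_maps_eqI[OF conn \<alpha> E(2,3)]) (use c d \<alpha> in \<open>simp add: compose_def\<close>)
  ultimately have "c \<in> Bij \<Omega>"
    using c(1) d(1) by (intro Bij_inverse[of _ _ d]) auto
  then show thesis
    using c by (intro that[of c]) (simp_all add: centraliser_eq[OF \<theta>] del: equivariant_maps.simps)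
qed

lemma centraliser_stabilizer:
  assumes \<theta>: "\<theta> \<in> hom \<Gamma> (Sym \<Omega>)" and c: "c \<in> centraliser (Sym \<Omega>) (\<theta> ` carrier \<Gamma>)"
    and x: "x \<in> \<Omega>"
  shows "stabilizer \<Gamma> \<theta> (c x) = stabilizer \<Gamma> \<theta> x"
proof -
  have "inj_on c \<Omega>" and eq: "\<And>g. g \<in> carrier \<Gamma> \<Longrightarrow> c (\<theta> g x) = \<theta> g (c x)"
    using c x by (auto simp: centraliser_eq[OF \<theta>] Bij_def bij_betw_def)
  then have "\<theta> g (c x) = c x \<longleftrightarrow> \<theta> g x = x" if "g \<in> carrier \<Gamma>" for g
    using perm_rep_closed[OF \<theta> that x] x that by (metis inj_onD)
  then show ?thesis
    by (auto simp: stabilizer_def)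
qed

text \<open>The isomorphism comes from \<open>n \<mapsto> c\<^sub>n\<close>, where \<open>c\<^sub>n\<close> is the centralising permutation with
  \<open>\<alpha> c\<^sub>n = \<alpha> n\<inverse>\<close>. It is stated for an arbitrary group with a connected representation, so that it
  serves both for the parent group and for the monodromy group.\<close>

theorem centraliser_iso_normalizer_quotient:
  fixes \<Gamma> (structure)
  assumes \<Gamma>: "group \<Gamma>" and \<theta>: "\<theta> \<in> hom \<Gamma> (Sym \<Omega>)" and conn: "connected_rep \<Gamma> \<Omega> \<theta>"
    and \<alpha>: "\<alpha> \<in> \<Omega>"
  shows "(Sym \<Omega>)\<lparr>carrier := centraliser (Sym \<Omega>) (\<theta> ` carrier \<Gamma>)\<rparr> \<cong>
    normalizer_quotient \<Gamma> (stabilizer \<Gamma> \<theta> \<alpha>)"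
proof -
  interpret group \<Gamma> by fact
  let ?M = "stabilizer \<Gamma> \<theta> \<alpha>"
  let ?N = "normalizer \<Gamma> ?M"
  let ?C = "centraliser (Sym \<Omega>) (\<theta> ` carrier \<Gamma>)"
  let ?CG = "(Sym \<Omega>)\<lparr>carrier := ?C\<rparr>"
  let ?NG = "\<Gamma>\<lparr>carrier := ?N\<rparr>"
  note N_iff = mem_normalizer_stabilizer_iff[OF \<Gamma> \<theta> \<alpha>]
  have "subgroup ?C (Sym \<Omega>)"
    using perm_rep_Bij[OF \<theta>] by (intro subgroup_centraliser group_Sym) (auto simp: carrier_Sym)
  then have C: "group ?CG" and C_mult: "\<And>a b. a \<in> ?C \<Longrightarrow> b \<in> ?C \<Longrightarrow> a \<otimes>\<^bsub>Sym \<Omega>\<^esub> b \<in> ?C"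
    and C_one: "\<one>\<^bsub>Sym \<Omega>\<^esub> \<in> ?C"
    by (auto intro: group_Sym subgroup.subgroup_is_group dest: subgroup.m_closed subgroup.one_closed)
  have sub: "subgroup ?N \<Gamma>"
    by (rule normalizer_imp_subgroup) (auto simp: stabilizer_def)
  have N: "group ?NG"
    by (rule subgroup.subgroup_is_group[OF sub \<Gamma>])
  have C_eqI: "c = d" if "c \<in> ?C" "d \<in> ?C" "c \<alpha> = d \<alpha>" for c d
    by (rule equivariant_maps_eqI[OF conn \<alpha>, of c \<Omega> \<theta> d])
      (use that in \<open>simp_all add: centraliser_eq[OF \<theta>] del: equivariant_maps.simps\<close>)
  have "\<exists>c. c \<in> ?C \<and> c \<alpha> = \<theta> (inv n) \<alpha>" if "n \<in> ?N" for n
    using that centraliser_elem_exists[OF \<Gamma> \<theta> conn \<alpha>, of "\<theta> (inv n) \<alpha>"]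
      perm_rep_closed[OF \<theta> _ \<alpha>, of "inv n"] by (metis N_iff inv_closed)
  then obtain h where h: "\<And>n. n \<in> ?N \<Longrightarrow> h n \<in> ?C" "\<And>n. n \<in> ?N \<Longrightarrow> h n \<alpha> = \<theta> (inv n) \<alpha>"
    by metis
  have hom: "h (n \<otimes> m) = h n \<otimes>\<^bsub>Sym \<Omega>\<^esub> h m" if n: "n \<in> ?N" and m: "m \<in> ?N" for n m
  proof (rule C_eqI)
    have nm: "n \<in> carrier \<Gamma>" "m \<in> carrier \<Gamma>"
      using n m N_iff by auto
    show "h (n \<otimes> m) \<in> ?C"
      using h(1) subgroup.m_closed[OF sub n m] .
    show "h n \<otimes>\<^bsub>Sym \<Omega>\<^esub> h m \<in> ?C"
      by (intro C_mult h n m)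
    have "(h n \<otimes>\<^bsub>Sym \<Omega>\<^esub> h m) \<alpha> = h m (\<theta> (inv n) \<alpha>)"
      using h(1)[OF n] h(1)[OF m] \<alpha> by (simp add: centraliser_eq[OF \<theta>] mult_Sym compose_def h(2)[OF n])
    also have "\<dots> = \<theta> (inv n) (h m \<alpha>)"
      using h(1)[OF m] nm \<alpha> by (simp add: centraliser_eq[OF \<theta>])
    also have "\<dots> = \<theta> (inv (n \<otimes> m)) \<alpha>"
      using nm \<alpha> by (simp add: h(2)[OF m] inv_mult_group perm_rep_mult[OF \<theta>])
    finally show "h (n \<otimes> m) \<alpha> = (h n \<otimes>\<^bsub>Sym \<Omega>\<^esub> h m) \<alpha>"
      using h(2)[OF subgroup.m_closed[OF sub n m]] by simp
  qed
  interpret h: group_hom ?NG ?CG h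
    using N C h(1) hom by (auto simp: group_hom_def group_hom_axioms_def hom_def)
  have fix_inv: "\<theta> (inv n) \<alpha> = \<alpha> \<longleftrightarrow> \<theta> n \<alpha> = \<alpha>" if "n \<in> carrier \<Gamma>" for n
    using perm_rep_inv[OF \<Gamma> \<theta> that \<alpha>] by metis
  have "?M \<subseteq> ?N"
  proof
    fix n assume "n \<in> ?M"
    then have "n \<in> carrier \<Gamma>" "\<theta> (inv n) \<alpha> = \<alpha>"
      using fix_inv by (auto simp: stabilizer_def)
    then show "n \<in> ?N"
      by (simp add: N_iff)
  qed
  moreover have "h n = \<one>\<^bsub>Sym \<Omega>\<^esub> \<longleftrightarrow> n \<in> ?M" if n: "n \<in> ?N" for n
  proof -
    have "h n = \<one>\<^bsub>Sym \<Omega>\<^esub> \<longleftrightarrow> h n \<alpha> = \<alpha>"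
      using C_eqI[OF h(1)[OF n] C_one] \<alpha> by (auto simp: one_Sym)
    moreover have "n \<in> carrier \<Gamma>"
      using n N_iff by blast
    ultimately show ?thesis
      using fix_inv[of n] by (simp add: h(2)[OF n] stabilizer_def)
  qed
  ultimately have ker: "kernel ?NG ?CG h = ?M"
    by (auto simp: kernel_def)
  have "h ` ?N = ?C"
  proof (intro equalityI subsetI)
    fix c assume c: "c \<in> ?C"
    then have "c \<alpha> \<in> \<Omega>"
      using \<alpha> by (auto simp: centraliser_eq[OF \<theta>])
    then obtain g where g: "g \<in> carrier \<Gamma>" "c \<alpha> = \<theta> g \<alpha>"
      using connected_rep_obtain[OF conn \<alpha>] by metis
    then have N_g: "inv g \<in> ?N"
      using centraliser_stabilizer[OF \<theta> c \<alpha>] by (simp add: N_iff)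
    have "h (inv g) \<alpha> = c \<alpha>"
      using g by (simp only: h(2)[OF N_g] inv_inv)
    then have "h (inv g) = c"
      by (rule C_eqI[OF h(1)[OF N_g] c])
    with N_g show "c \<in> h ` ?N" by blast
  qed (use h(1) in auto)
  then have "normalizer_quotient \<Gamma> ?M \<cong> ?CG"
    using h.FactGroup_iso ker by (simp add: normalizer_quotient_def)
  moreover have "group (normalizer_quotient \<Gamma> ?M)"
    using normal.factorgroup_is_group[OF h.normal_kernel] ker by (simp add: normalizer_quotient_def)
  ultimately show ?thesis
    by (metis group.iso_sym)
qed

section \<open>Parent group and monodromy group\<close>

lemma group_monodromy_group:
  assumes "group \<Gamma>" "\<theta> \<in> hom \<Gamma> (Sym \<Omega>)"
  shows "group (monodromy_group \<Gamma> \<Omega> \<theta>)"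
proof -
  interpret group_hom \<Gamma> "Sym \<Omega>" \<theta>
    using assms group_Sym by (simp add: group_hom_def group_hom_axioms_def)
  show ?thesis
    unfolding monodromy_group_def by (rule subgroup.subgroup_is_group[OF img_is_subgroup group_Sym])
qed

lemma monodromy_group_rep:
  "\<theta> \<in> hom \<Gamma> (Sym \<Omega>) \<Longrightarrow> (\<lambda>g. g) \<in> hom (monodromy_group \<Gamma> \<Omega> \<theta>) (Sym \<Omega>)"
  by (auto simp: monodromy_group_def hom_def)

lemma connected_rep_monodromy_group:
  "connected_rep (monodromy_group \<Gamma> \<Omega> \<theta>) \<Omega> (\<lambda>g. g) \<longleftrightarrow> connected_rep \<Gamma> \<Omega> \<theta>"
proof -
  have "orbit (monodromy_group \<Gamma> \<Omega> \<theta>) (\<lambda>g. g) x = orbit \<Gamma> \<theta> x" for x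
    by (auto simp: orbit_def monodromy_group_def)
  then show ?thesis
    by (simp add: connected_rep_def)
qed

theorem theorem1:
  fixes \<Gamma> :: "('g, 'p) monoid_scheme"
    and \<CC> :: "('o, 'm) cat"
    and rep :: "'o \<Rightarrow> 'w set \<times> ('g \<Rightarrow> 'w \<Rightarrow> 'w)"
    and fn :: "'m \<Rightarrow> 'w \<Rightarrow> 'w"
    and A :: 'o
    and \<Omega> :: "'w set"
    and \<theta> :: "'g \<Rightarrow> 'w \<Rightarrow> 'w"
    and \<alpha> :: 'w
  assumes "permutational_category \<Gamma> \<CC> rep fn"
    and "A \<in> Obj \<CC>"
    and "rep A = (\<Omega>, \<theta>)"
    and "connected_rep \<Gamma> \<Omega> \<theta>"
    and "\<alpha> \<in> \<Omega>"
  defines "G \<equiv> monodromy_group \<Gamma> \<Omega> \<theta>"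
  defines "H \<equiv> stabilizer G (\<lambda>g. g) \<alpha>"
    and "M \<equiv> stabilizer \<Gamma> \<theta> \<alpha>"
  shows "Aut \<CC> A \<cong> normalizer_quotient G H
    \<and> normalizer_quotient G H \<cong> normalizer_quotient \<Gamma> M"
proof -
  interpret permutational_category \<Gamma> \<CC> rep fn by fact
  let ?C = "(Sym \<Omega>)\<lparr>carrier := centraliser (Sym \<Omega>) (carrier G)\<rparr>"
  have \<theta>: "\<theta> \<in> hom \<Gamma> (Sym \<Omega>)"
    using rep_perm_reps[OF assms(2)] assms(3) by (simp add: perm_reps_def)
  have carrier_G: "carrier G = \<theta> ` carrier \<Gamma>"
    by (simp add: G_def monodromy_group_def)
  have Aut: "Aut \<CC> A \<cong> ?C"
    using Aut_iso_centraliser[OF assms(2,3)] unfolding G_def by (rule is_isoI)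
  have C_\<Gamma>: "?C \<cong> normalizer_quotient \<Gamma> M"
    using centraliser_iso_normalizer_quotient[OF is_group \<theta> assms(4,5)]
    by (simp add: carrier_G M_def)
  have "group G" "(\<lambda>g. g) \<in> hom G (Sym \<Omega>)" "connected_rep G \<Omega> (\<lambda>g. g)"
    using group_monodromy_group[OF is_group \<theta>] monodromy_group_rep[OF \<theta>] assms(4)
    by (simp_all add: G_def connected_rep_monodromy_group)
  then have C_G: "?C \<cong> normalizer_quotient G H"
    using centraliser_iso_normalizer_quotient[of G "\<lambda>g. g" \<Omega> \<alpha>] assms(5) by (simp add: H_def)
  have "group ?C"
    using perm_rep_Bij[OF \<theta>]
    by (intro subgroup.subgroup_is_group[OF subgroup_centraliser] group_Sym)
      (auto simp: carrier_G carrier_Sym)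
  then show ?thesis
    using iso_trans[OF Aut C_G] iso_trans[OF group.iso_sym[OF _ C_G] C_\<Gamma>] by blast
qed

end
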